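(* Let $0<a<b$ be real numbers, let $\alpha\in(0,1)$, and let $x:[a,b]\to\mathbb{R}$ be a function of class $C^2$. For each integer $n\ge 1$ put $\triangle T=\frac{\ln(b/a)}{n}$ and, for $N\in\{0,1,\ldots,n\}$, $t_N=a\exp(N\triangle T)$ and $x_N=x(t_N)$. Put $$\psi=\frac{(\triangle T)^{1-\alpha}}{a(1-\exp(-\triangle T))\,\Gamma(2-\alpha)},\qquad \omega_k^{\alpha}=k^{1-\alpha}-(k-1)^{1-\alpha}\quad (k\ge 1),$$ and, for $N\in\{1,\ldots,n\}$, $$\widetilde{\mathcal{D}}^{\alpha}_{n,N}x=\frac{x(a)}{\Gamma(1-\alpha)}\left(\ln\frac{t_N}{a}\right)^{-\alpha}+\psi\sum_{k=1}^{N}\omega_{N-k+1}^{\alpha}\,\frac{x_k-x_{k-1}}{\exp(k\triangle T)}\,t_k .$$ Then for every $n\ge 1$ and every $N\in\{1,\ldots,n\}$, $${}_a\mathcal{D}_{t}^{\alpha}x(t)\big|_{t=t_N}=\widetilde{\mathcal{D}}^{\alpha}_{n,N}x+R_{n,N},$$ where the remainder satisfies $R_{n,N}=O(\triangle T)$, that is, there is a constant $C$ (depending on $a,b,\alpha,x$ but not on $n$ or $N$) with $|R_{n,N}|\le C\,\triangle T$ for all $n\ge 1$ and all $N\in\{1,\ldots,n\}$; in particular $\max_{1\le N\le n}|R_{n,N}|\to 0$ as $\triangle T\to 0$ (i.e. as $n\to\infty$).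
   Context: $\Gamma$ denotes the Gamma function. For $\alpha\in(0,1)$, $0<a<b$ and $x:[a,b]\to\mathbb{R}$, the left Hadamard fractional derivative of order $\alpha$ is $${}_a\mathcal{D}_t^{\alpha}x(t)=\frac{t}{\Gamma(1-\alpha)}\frac{d}{dt}\int_a^t\left(\ln\frac{t}{\tau}\right)^{-\alpha}\frac{x(\tau)}{\tau}\,d\tau,\qquad t\in(a,b],$$ where at $t=b$ the derivative $d/dt$ is understood as the one-sided (left) derivative, since $x$ is only defined on $[a,b]$. The convention $0^{1-\alpha}=0$ is used, so $\omega_1^{\alpha}=1$. *)

theory Defs
  imports "HOL-Analysis.Analysis"
begin

(* One-sided derivatives at the endpoints: only the values of x on {a..b} matter. *)
definition C2_on :: "real \<Rightarrow> real \<Rightarrow> (real \<Rightarrow> real) \<Rightarrow> bool" where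
  "C2_on a b x \<longleftrightarrow>
     (\<exists>x' x''.
        (\<forall>t\<in>{a..b}. (x has_real_derivative x' t) (at t within {a..b})) \<and>
        (\<forall>t\<in>{a..b}. (x' has_real_derivative x'' t) (at t within {a..b})) \<and>
        continuous_on {a..b} x'')"

(* The kernel is singular at s = t, where it gets the value 0 because 0 powr r = 0;
   a single point does not affect the integral below. *)
definition hadamard_integrand :: "real \<Rightarrow> (real \<Rightarrow> real) \<Rightarrow> real \<Rightarrow> real \<Rightarrow> real" where
  "hadamard_integrand \<alpha> x t s = ln (t / s) powr (- \<alpha>) * (x s / s)"

definition hadamard_integral :: "real \<Rightarrow> real \<Rightarrow> (real \<Rightarrow> real) \<Rightarrow> real \<Rightarrow> real" where
  "hadamard_integral \<alpha> a x t = integral {a..t} (hadamard_integrand \<alpha> x t)"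

(* The derivative relative to {a..b} is the ordinary one for a < t < b and the left
   derivative for t = b. Both integral and vector_derivative are total, so the value of
   hadamard_deriv is meaningful only under hadamard_differentiable. *)
definition hadamard_deriv ::
  "real \<Rightarrow> real \<Rightarrow> real \<Rightarrow> (real \<Rightarrow> real) \<Rightarrow> real \<Rightarrow> real" where
  "hadamard_deriv \<alpha> a b x t =
     t / Gamma (1 - \<alpha>) * vector_derivative (hadamard_integral \<alpha> a x) (at t within {a..b})"

definition hadamard_differentiable ::
  "real \<Rightarrow> real \<Rightarrow> real \<Rightarrow> (real \<Rightarrow> real) \<Rightarrow> real \<Rightarrow> bool" where
  "hadamard_differentiable \<alpha> a b x t \<longleftrightarrow>
     (\<forall>u\<in>{a..b}. hadamard_integrand \<alpha> x u absolutely_integrable_on {a..u}) \<and>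
     hadamard_integral \<alpha> a x differentiable (at t within {a..b})"

definition log_step :: "real \<Rightarrow> real \<Rightarrow> nat \<Rightarrow> real" where
  "log_step a b n = ln (b / a) / real n"

definition node :: "real \<Rightarrow> real \<Rightarrow> nat \<Rightarrow> nat \<Rightarrow> real" where
  "node a b n k = a * exp (real k * log_step a b n)"

definition psi :: "real \<Rightarrow> real \<Rightarrow> real \<Rightarrow> nat \<Rightarrow> real" where
  "psi \<alpha> a b n =
     log_step a b n powr (1 - \<alpha>) / (a * (1 - exp (- log_step a b n)) * Gamma (2 - \<alpha>))"

definition omega :: "real \<Rightarrow> nat \<Rightarrow> real" where
  "omega \<alpha> k = real k powr (1 - \<alpha>) - (real k - 1) powr (1 - \<alpha>)"

definition hadamard_approx ::
  "real \<Rightarrow> real \<Rightarrow> real \<Rightarrow> (real \<Rightarrow> real) \<Rightarrow> nat \<Rightarrow> nat \<Rightarrow> real" where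
  "hadamard_approx \<alpha> a b x n N =
     x a / Gamma (1 - \<alpha>) * ln (node a b n N / a) powr (- \<alpha>) +
     psi \<alpha> a b n *
       (\<Sum>k=1..N. omega \<alpha> (N - k + 1) *
          ((x (node a b n k) - x (node a b n (k - 1))) / exp (real k * log_step a b n)) *
          node a b n k)"

end

theory Submission
  imports Defs
begin

text \<open>
  With \<open>f u = x (a exp u)\<close> and \<open>T = ln (t / a)\<close> the Hadamard derivative is
  \<open>d/dT \<integral>\<^sub>0\<^sup>T (T - s)\<^sup>-\<^sup>\<alpha> f s ds / \<Gamma>(1 - \<alpha>)\<close>. Integrating by parts twice turns the singular kernel into
  \<open>(T - s)\<^sup>2\<^sup>-\<^sup>\<alpha>\<close>, which is \<open>C\<^sup>1\<close> when extended by \<open>0\<close> to \<open>s > T\<close>, so that the Leibniz rule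
  over a fixed interval applies; undoing one integration by parts gives
  \<open>T\<^sup>-\<^sup>\<alpha> f 0 + \<integral>\<^sub>0\<^sup>T (T - s)\<^sup>-\<^sup>\<alpha> f' s ds\<close>.
  The scheme integrates the kernel exactly on each cell of length \<open>h\<close> and replaces \<open>f'\<close> there by
  \<open>\<Delta>f / (1 - exp (- h))\<close>, which differs from \<open>f'\<close> by at most \<open>(sup \<bar>f'\<bar> + sup \<bar>f''\<bar>) h\<close>.
\<close>

section \<open>Integration by parts against the Abel kernel\<close>

text \<open>Since \<open>p + 1 > 0\<close>, the antiderivative
  \<open>- (T - s) powr (p + 1) / (p + 1)\<close> of the kernel is continuous up to
  \<open>s = T\<close>. The fundamental theorem with differentiability only in the interior
  therefore covers the singular case \<open>d = T\<close>, and integrability of the singular product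
  comes out as part of the conclusion.\<close>

lemma has_integral_abel_kernel_by_parts:
  fixes f f' :: "real \<Rightarrow> real" and p c d T :: real
  assumes "-1 < p" "c \<le> d" "d \<le> T"
    and f: "\<And>s. s \<in> {c..d} \<Longrightarrow> (f has_real_derivative f' s) (at s within {c..d})"
    and f': "continuous_on {c..d} f'"
  shows "((\<lambda>s. (T - s) powr p * f s) has_integral
     ((T - c) powr (p + 1) * f c - (T - d) powr (p + 1) * f d
       + integral {c..d} (\<lambda>s. (T - s) powr (p + 1) * f' s)) / (p + 1)) {c..d}"
proof -
  define F where "F = (\<lambda>s. - ((T - s) powr (p + 1) * f s) / (p + 1))"
  define G where "G = (\<lambda>s. (T - s) powr (p + 1) * f' s)"
  have contf: "continuous_on {c..d} f"
    by (rule DERIV_continuous_on[OF f])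
  have contk: "continuous_on {c..d} (\<lambda>s. (T - s) powr (p + 1))"
    using assms by (intro continuous_on_powr' continuous_intros) auto
  have "((\<lambda>s. (T - s) powr p * f s - G s / (p + 1)) has_integral F d - F c) {c..d}"
  proof (rule fundamental_theorem_of_calculus_interior)
    show "continuous_on {c..d} F"
      unfolding F_def using assms by (intro continuous_intros contf contk) auto
    fix s assume s: "s \<in> {c<..<d}"
    have "(f has_real_derivative f' s) (at s)"
      using f[of s] s at_within_interior[of s "{c..d}"] by simp
    moreover have "((\<lambda>s. (T - s) powr (p + 1)) has_real_derivative - ((p + 1) * (T - s) powr p)) (at s)"
      using s assms by (auto intro!: derivative_eq_intros)
    ultimately have "(F has_real_derivative
        - (- ((p + 1) * (T - s) powr p) * f s + f' s * (T - s) powr (p + 1)) / (p + 1)) (at s)"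
      unfolding F_def by (intro DERIV_cdivide DERIV_minus DERIV_mult)
    also have "- (- ((p + 1) * (T - s) powr p) * f s + f' s * (T - s) powr (p + 1)) / (p + 1)
        = (T - s) powr p * f s - G s / (p + 1)"
      using assms(1) unfolding G_def by (simp add: diff_divide_distrib)
    finally show "(F has_vector_derivative (T - s) powr p * f s - G s / (p + 1)) (at s)"
      by (simp add: has_real_derivative_iff_has_vector_derivative)
  qed fact
  moreover have "(G has_integral integral {c..d} G) {c..d}"
    unfolding G_def by (intro integrable_integral integrable_continuous_real continuous_intros contk f')
  ultimately have "((\<lambda>s. ((T - s) powr p * f s - G s / (p + 1)) + G s / (p + 1)) has_integral
      (F d - F c) + integral {c..d} G / (p + 1)) {c..d}"
    by (intro has_integral_add has_integral_divide)
  then show ?thesis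
    unfolding F_def G_def by (simp add: diff_divide_distrib add_divide_distrib)
qed

lemma has_integral_abel_kernel:
  fixes p c d T :: real
  assumes "-1 < p" "c \<le> d" "d \<le> T"
  shows "((\<lambda>s. (T - s) powr p) has_integral
     ((T - c) powr (p + 1) - (T - d) powr (p + 1)) / (p + 1)) {c..d}"
  using has_integral_abel_kernel_by_parts[OF assms, of "\<lambda>_. 1" "\<lambda>_. 0"] by simp

section \<open>Differentiation and absolute integrability of Abel integrals\<close>

text \<open>The only delicate point is \<open>z = 0\<close>: there the difference quotient is
  \<open>max h 0 powr (p - 1)\<close>, which tends to 0 because \<open>p > 1\<close>.\<close>

lemma has_real_derivative_pos_part_powr:
  fixes p z :: real
  assumes "1 < p"
  shows "((\<lambda>z. max z 0 powr p) has_real_derivative p * max z 0 powr (p - 1)) (at z)"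
proof -
  consider "z > 0" | "z < 0" | "z = 0" by linarith
  then show ?thesis
  proof cases
    case 1
    have "((\<lambda>z. z powr p) has_real_derivative p * z powr (p - 1)) (at z)"
      using 1 by (rule has_real_derivative_powr)
    then show ?thesis
      using has_field_derivative_transform_within_open[of "\<lambda>z. z powr p" _ z "{0<..}" "\<lambda>z. max z 0 powr p"] 1
      by simp
  next
    case 2
    then show ?thesis
      using has_field_derivative_transform_within_open[of "\<lambda>z. 0" 0 z "{..<0}" "\<lambda>z. max z 0 powr p"]
      by simp
  next
    case 3
    have "continuous_on UNIV (\<lambda>h::real. max h 0 powr (p - 1))"
      using assms by (intro continuous_on_powr' continuous_intros) auto
    then have "((\<lambda>h::real. max h 0 powr (p - 1)) \<longlongrightarrow> max 0 0 powr (p - 1)) (at 0)"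
      by (metis continuous_on_def UNIV_I)
    \<comment> \<open>For \<open>h \<le> 0\<close> both sides are 0, because
      \<open>0 powr r = 0\<close> for every \<open>r\<close>.\<close>
    moreover have "max h 0 powr p / h = max h 0 powr (p - 1)" for h :: real
      by (cases "h > 0") (auto simp: max_def powr_diff)
    ultimately show ?thesis
      using 3 assms by (simp add: has_field_derivative_iff)
  qed
qed

text \<open>Moves the dependence on \<open>t\<close> from the limits of integration into the kernel.
  By \<open>0 powr q = 0\<close> the cut-off integrand vanishes for \<open>s \<ge> t\<close>,
  whatever the sign of \<open>q\<close>.\<close>

lemma integral_abel_kernel_pos_part:
  fixes g :: "real \<Rightarrow> real" and q t L :: real
  assumes "t \<in> {0..L}"
  shows "integral {0..t} (\<lambda>s. (t - s) powr q * g s) = integral {0..L} (\<lambda>s. max (t - s) 0 powr q * g s)"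
proof -
  have "integral {0..L} (\<lambda>s. max (t - s) 0 powr q * g s) =
      integral {0..L} (\<lambda>s. if s \<in> {0..t} then (t - s) powr q * g s else 0)"
    using assms by (intro integral_cong) (auto simp: max_def)
  also have "\<dots> = integral ({0..t} \<inter> {0..L}) (\<lambda>s. (t - s) powr q * g s)"
    by (rule integral_restrict_Int)
  also have "{0..t} \<inter> {0..L} = {0..t}" using assms by auto
  finally show ?thesis by simp
qed

lemma has_real_derivative_abel_integral:
  fixes f f' f'' :: "real \<Rightarrow> real" and \<alpha> L T :: real
  assumes \<alpha>: "0 < \<alpha>" "\<alpha> < 1" and T: "0 < T" "T \<le> L"
    and f: "\<And>s. s \<in> {0..L} \<Longrightarrow> (f has_real_derivative f' s) (at s within {0..L})"
    and f': "\<And>s. s \<in> {0..L} \<Longrightarrow> (f' has_real_derivative f'' s) (at s within {0..L})"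
    and f'': "continuous_on {0..L} f''"
  shows "((\<lambda>t. integral {0..t} (\<lambda>s. (t - s) powr (- \<alpha>) * f s)) has_real_derivative
     T powr (- \<alpha>) * f 0 + integral {0..T} (\<lambda>s. (T - s) powr (- \<alpha>) * f' s)) (at T within {0..L})"
proof -
  \<comment> \<open>The domain of integration is fixed, so the Leibniz rule can apply to
    \<open>K\<close>.\<close>
  define K where "K = (\<lambda>q t. integral {0..L} (\<lambda>s. max (t - s) 0 powr q * f'' s))"
  have contf': "continuous_on {0..L} f'"
    by (rule DERIV_continuous_on[OF f'])
  have f'2: "((f' has_real_derivative f'' s) (at s within {0..t}))"
    and f2: "((f has_real_derivative f' s) (at s within {0..t}))" if "s \<in> {0..t}" "t \<le> L" for s t
    using f[of s] f'[of s] that by (auto intro: DERIV_subset)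
  have sub: "continuous_on {0..t} f'" "continuous_on {0..t} f''" if "t \<le> L" for t
    using contf' f'' that by (auto intro: continuous_on_subset)
  \<comment> \<open>Used twice: with \<open>p = 2 - \<alpha>\<close> as the second integration by
    parts inside \<open>J\<close>, and with \<open>p = 1 - \<alpha>\<close> at the end, to read the
    differentiated expression backwards as an integral of \<open>f'\<close>.\<close>
  have J': "integral {0..t} (\<lambda>s. (t - s) powr (p - 1) * f' s) = (t powr p * f' 0 + K p t) / p"
    if "t \<in> {0..L}" "0 < p" for t p
  proof (rule integral_unique)
    have "((\<lambda>s. (t - s) powr (p - 1) * f' s) has_integral
      ((t - 0) powr (p - 1 + 1) * f' 0 - (t - t) powr (p - 1 + 1) * f' t
       + integral {0..t} (\<lambda>s. (t - s) powr (p - 1 + 1) * f'' s)) / (p - 1 + 1)) {0..t}"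
      by (rule has_integral_abel_kernel_by_parts) (use that in \<open>auto intro: f'2 sub\<close>)
    then show "((\<lambda>s. (t - s) powr (p - 1) * f' s) has_integral (t powr p * f' 0 + K p t) / p) {0..t}"
      using that integral_abel_kernel_pos_part[OF that(1)] by (simp add: K_def)
  qed
  have J: "integral {0..t} (\<lambda>s. (t - s) powr (- \<alpha>) * f s) =
      (t powr (1 - \<alpha>) * f 0 + (t powr (2 - \<alpha>) * f' 0 + K (2 - \<alpha>) t) / (2 - \<alpha>)) / (1 - \<alpha>)"
    if "t \<in> {0..L}" for t
  proof (rule integral_unique)
    have "((\<lambda>s. (t - s) powr (- \<alpha>) * f s) has_integral
      ((t - 0) powr (- \<alpha> + 1) * f 0 - (t - t) powr (- \<alpha> + 1) * f t
       + integral {0..t} (\<lambda>s. (t - s) powr (- \<alpha> + 1) * f' s)) / (- \<alpha> + 1)) {0..t}"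
      by (rule has_integral_abel_kernel_by_parts) (use that \<alpha> in \<open>auto intro: f2 sub\<close>)
    then show "((\<lambda>s. (t - s) powr (- \<alpha>) * f s) has_integral
      (t powr (1 - \<alpha>) * f 0 + (t powr (2 - \<alpha>) * f' 0 + K (2 - \<alpha>) t) / (2 - \<alpha>)) / (1 - \<alpha>)) {0..t}"
      using J'[OF that, of "2 - \<alpha>"] \<alpha> by simp
  qed
  have contk: "continuous_on S (\<lambda>z. max (g z) 0 powr q)" if "0 < q" "continuous_on S g"
    for q and S :: "'c::t2_space set" and g :: "'c \<Rightarrow> real"
    using that by (intro continuous_on_powr' continuous_intros) auto
  \<comment> \<open>The exponent left after differentiating is \<open>1 - \<alpha> > 0\<close>, so
    the differentiated integrand is jointly continuous in \<open>(t, s)\<close>, as the Leibniz rule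
    demands.\<close>
  have "((\<lambda>t. integral (cbox 0 L) (\<lambda>s. max (t - s) 0 powr (2 - \<alpha>) * f'' s)) has_real_derivative
      integral (cbox 0 L) (\<lambda>s. ((2 - \<alpha>) * max (T - s) 0 powr (1 - \<alpha>)) * f'' s)) (at T within {0..L})"
  proof (rule leibniz_rule_field_derivative)
    fix t s :: real
    have "((\<lambda>t. max (t - s) 0 powr (2 - \<alpha>)) has_real_derivative
        ((2 - \<alpha>) * max (t - s) 0 powr (1 - \<alpha>)) * 1) (at t within {0..L})"
      using has_real_derivative_pos_part_powr[of "2 - \<alpha>" "t - s"] \<alpha>
      by (intro DERIV_chain2[where g = "\<lambda>t. t - s"]) (auto intro!: derivative_eq_intros)
    then show "((\<lambda>t. max (t - s) 0 powr (2 - \<alpha>) * f'' s) has_real_derivative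
        ((2 - \<alpha>) * max (t - s) 0 powr (1 - \<alpha>)) * f'' s) (at t within {0..L})"
      by (simp add: DERIV_cmult_right)
  next
    fix t :: real
    show "(\<lambda>s. max (t - s) 0 powr (2 - \<alpha>) * f'' s) integrable_on cbox 0 L"
      unfolding box_real using \<alpha>
      by (intro integrable_continuous_real continuous_intros contk f'') auto
  next
    have "continuous_on ({0..L} \<times> cbox 0 L) (\<lambda>p. f'' (snd p))"
      by (rule continuous_on_compose2[OF f'']) (auto intro: continuous_on_snd continuous_on_id)
    moreover have "continuous_on ({0..L} \<times> cbox 0 L) (\<lambda>p. max (fst p - snd p) 0 powr (1 - \<alpha>))"
      using \<alpha> by (intro contk continuous_intros) auto
    ultimately show "continuous_on ({0..L} \<times> cbox 0 L)
        (\<lambda>(t, s). ((2 - \<alpha>) * max (t - s) 0 powr (1 - \<alpha>)) * f'' s)"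
      unfolding case_prod_beta by (intro continuous_on_mult continuous_on_const)
  qed (use T in auto)
  then have "(K (2 - \<alpha>) has_real_derivative (2 - \<alpha>) * K (1 - \<alpha>) T) (at T within {0..L})"
    by (simp add: K_def mult.assoc)
  \<comment> \<open>Here \<open>T > 0\<close> enters: the boundary power
    \<open>t powr (1 - \<alpha>)\<close> is not differentiable at 0.\<close>
  moreover have "((\<lambda>t. t powr q) has_real_derivative q * T powr (q - 1)) (at T within {0..L})" for q
    using T has_real_derivative_powr[of T q] by (auto intro: has_field_derivative_at_within)
  from this[of "1 - \<alpha>"] this[of "2 - \<alpha>"]
  have "((\<lambda>t. t powr (1 - \<alpha>)) has_real_derivative (1 - \<alpha>) * T powr (- \<alpha>)) (at T within {0..L})"
    and "((\<lambda>t. t powr (2 - \<alpha>)) has_real_derivative (2 - \<alpha>) * T powr (1 - \<alpha>)) (at T within {0..L})"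
    by simp_all
  ultimately have "((\<lambda>t. (t powr (1 - \<alpha>) * f 0 + (t powr (2 - \<alpha>) * f' 0 + K (2 - \<alpha>) t) / (2 - \<alpha>)) / (1 - \<alpha>))
      has_real_derivative
      ((1 - \<alpha>) * T powr (- \<alpha>) * f 0
        + ((2 - \<alpha>) * T powr (1 - \<alpha>) * f' 0 + (2 - \<alpha>) * K (1 - \<alpha>) T) / (2 - \<alpha>)) / (1 - \<alpha>))
      (at T within {0..L})"
    by (intro DERIV_cdivide DERIV_add DERIV_cmult_right)
  moreover have "((1 - \<alpha>) * T powr (- \<alpha>) * f 0
        + ((2 - \<alpha>) * T powr (1 - \<alpha>) * f' 0 + (2 - \<alpha>) * K (1 - \<alpha>) T) / (2 - \<alpha>)) / (1 - \<alpha>)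
      = T powr (- \<alpha>) * f 0 + integral {0..T} (\<lambda>s. (T - s) powr (- \<alpha>) * f' s)"
  proof -
    have "integral {0..T} (\<lambda>s. (T - s) powr (- \<alpha>) * f' s) = (T powr (1 - \<alpha>) * f' 0 + K (1 - \<alpha>) T) / (1 - \<alpha>)"
      using J'[of T "1 - \<alpha>"] T \<alpha> by simp
    then show ?thesis
      using \<alpha> by (simp add: add_divide_distrib)
  qed
  ultimately have D: "((\<lambda>t. (t powr (1 - \<alpha>) * f 0 + (t powr (2 - \<alpha>) * f' 0 + K (2 - \<alpha>) t) / (2 - \<alpha>)) / (1 - \<alpha>))
      has_real_derivative T powr (- \<alpha>) * f 0 + integral {0..T} (\<lambda>s. (T - s) powr (- \<alpha>) * f' s))
      (at T within {0..L})"
    by (simp only:)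
  show ?thesis
  proof (rule has_field_derivative_transform_within[OF D zero_less_one])
    show "T \<in> {0..L}" using T by simp
  qed (simp only: J)
qed

text \<open>\<open>f\<close> is bounded on the compact interval and the kernel is nonnegative, so a
  multiple of the kernel dominates. The absolute form is what the change of variables below works
  with.\<close>

lemma abel_integrand_absolutely_integrable:
  fixes f :: "real \<Rightarrow> real"
  assumes "-1 < p" "c \<le> d" "d \<le> T" "(\<lambda>s. (T - s) powr p * f s) integrable_on {c..d}" "continuous_on {c..d} f"
  shows "(\<lambda>s. (T - s) powr p * f s) absolutely_integrable_on {c..d}"
proof -
  obtain B where B: "\<And>s. s \<in> {c..d} \<Longrightarrow> norm (f s) \<le> B"
    using compact_imp_bounded[OF compact_continuous_image[OF assms(5) compact_Icc]]
    unfolding bounded_iff by blast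
  show ?thesis
  proof (rule absolutely_integrable_integrable_bound)
    show "(\<lambda>s. (T - s) powr p * B) integrable_on {c..d}"
      by (intro integrable_on_mult_left has_integral_integrable[OF has_integral_abel_kernel] assms(1-3))
    show "norm ((T - s) powr p * f s) \<le> (T - s) powr p * B" if "s \<in> {c..d}" for s
      using B[OF that] by (auto simp: abs_mult intro!: mult_left_mono)
  qed fact
qed

section \<open>Local errors of the quadrature\<close>

text \<open>The kernel is nonnegative, so each cell contributes at most \<open>E\<close> times its
  exact kernel weight. The weights telescope, so the bound does not grow with the number of cells.
  Keeping \<open>T\<close> independent of \<open>u N\<close> lets the induction on \<open>N\<close>
  drop the last cell while the kernel stays the same.\<close>

lemma abel_piecewise_constant_error:
  fixes g u c :: "_ \<Rightarrow> real"
  assumes "-1 < p" and u: "\<And>k. k < N \<Longrightarrow> u k \<le> u (Suc k)" "u 0 = 0" "u N \<le> T"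
    and int: "(\<lambda>s. (T - s) powr p * g s) integrable_on {0..T}"
    and c: "\<And>k s. k < N \<Longrightarrow> s \<in> {u k..u (Suc k)} \<Longrightarrow> \<bar>g s - c (Suc k)\<bar> \<le> E"
  shows "\<bar>integral {0..u N} (\<lambda>s. (T - s) powr p * g s)
      - (\<Sum>k=1..N. c k * (((T - u (k - 1)) powr (p + 1) - (T - u k) powr (p + 1)) / (p + 1)))\<bar>
    \<le> E * ((T powr (p + 1) - (T - u N) powr (p + 1)) / (p + 1))"
  using u c
proof (induction N)
  case (Suc N)
  let ?G = "\<lambda>s. (T - s) powr p * g s"
  let ?w = "((T - u N) powr (p + 1) - (T - u (Suc N)) powr (p + 1)) / (p + 1)"
  have uN: "u N \<le> u (Suc N)" "u N \<le> T" using Suc.prems(1)[of N] Suc.prems(3) by auto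
  have nonneg: "0 \<le> u k" if "k \<le> N" for k
    using that
  proof (induction k)
    case (Suc k)
    then show ?case using Suc.prems \<open>\<And>k. k < Suc N \<Longrightarrow> u k \<le> u (Suc k)\<close>[of k] by simp
  qed (simp add: \<open>u 0 = 0\<close>)
  have int2: "?G integrable_on {x..y}" if "0 \<le> x" "y \<le> T" for x y
    using int that by (auto intro: integrable_on_subinterval)
  have w: "((\<lambda>s. (T - s) powr p) has_integral ?w) {u N..u (Suc N)}"
    by (rule has_integral_abel_kernel) (use assms(1) uN Suc.prems in auto)
  have "\<bar>integral {u N..u (Suc N)} (\<lambda>s. ?G s - (T - s) powr p * c (Suc N))\<bar>
      \<le> integral {u N..u (Suc N)} (\<lambda>s. (T - s) powr p * E)"
  proof (rule Henstock_Kurzweil_Integration.integral_norm_bound_integral[where 'a = real, unfolded real_norm_def])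
    show "(\<lambda>s. ?G s - (T - s) powr p * c (Suc N)) integrable_on {u N..u (Suc N)}"
      using nonneg Suc.prems
      by (intro integrable_diff int2 integrable_on_mult_left has_integral_integrable[OF w]) auto
    show "(\<lambda>s. (T - s) powr p * E) integrable_on {u N..u (Suc N)}"
      by (intro integrable_on_mult_left has_integral_integrable[OF w])
    fix s assume s: "s \<in> {u N..u (Suc N)}"
    have "\<bar>?G s - (T - s) powr p * c (Suc N)\<bar> = (T - s) powr p * \<bar>g s - c (Suc N)\<bar>"
      by (simp add: abs_mult flip: right_diff_distrib)
    also have "\<dots> \<le> (T - s) powr p * E"
      using Suc.prems(4)[of N s] s by (intro mult_left_mono) auto
    finally show "\<bar>?G s - (T - s) powr p * c (Suc N)\<bar> \<le> (T - s) powr p * E" .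
  qed
  also have "integral {u N..u (Suc N)} (\<lambda>s. (T - s) powr p * E) = ?w * E"
    by (intro integral_unique has_integral_mult_left w)
  also have "integral {u N..u (Suc N)} (\<lambda>s. ?G s - (T - s) powr p * c (Suc N))
      = integral {u N..u (Suc N)} ?G - ?w * c (Suc N)"
    using nonneg Suc.prems
    by (intro integral_unique has_integral_diff integrable_integral int2 has_integral_mult_left w) auto
  finally have 1: "\<bar>integral {u N..u (Suc N)} ?G - ?w * c (Suc N)\<bar> \<le> ?w * E" .
  have 2: "\<bar>integral {0..u N} ?G
      - (\<Sum>k=1..N. c k * (((T - u (k - 1)) powr (p + 1) - (T - u k) powr (p + 1)) / (p + 1)))\<bar>
    \<le> E * ((T powr (p + 1) - (T - u N) powr (p + 1)) / (p + 1))"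
    using Suc.prems uN by (intro Suc.IH) auto
  have 3: "integral {0..u (Suc N)} ?G = integral {0..u N} ?G + integral {u N..u (Suc N)} ?G"
    using uN nonneg Suc.prems by (intro Henstock_Kurzweil_Integration.integral_combine[symmetric] int2) auto
  have 4: "E * ((T powr (p + 1) - (T - u (Suc N)) powr (p + 1)) / (p + 1))
     = E * ((T powr (p + 1) - (T - u N) powr (p + 1)) / (p + 1)) + ?w * E"
    by (simp add: diff_divide_distrib algebra_simps)
  show ?case
    unfolding 3 4 using 1 2 by (simp add: mult.commute)
qed simp

text \<open>By the mean value theorem the difference of \<open>f\<close> is \<open>f' r * h\<close>
  for some \<open>r\<close> in the cell. Replacing \<open>f' s\<close> by \<open>f' r\<close> costs
  \<open>B * h\<close>; dividing by \<open>1 - exp (- h)\<close> instead of \<open>h\<close> costs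
  \<open>A * h\<close>, because \<open>h / (1 - exp (- h)) - 1 \<le> h\<close>.\<close>

lemma difference_quotient_error:
  fixes f f' :: "real \<Rightarrow> real"
  assumes "0 < h" "s \<in> {v..v + h}"
    and f: "\<And>s. s \<in> {v..v + h} \<Longrightarrow> (f has_real_derivative f' s) (at s within {v..v + h})"
    and A: "\<And>s. s \<in> {v..v + h} \<Longrightarrow> \<bar>f' s\<bar> \<le> A"
    and B: "\<And>s r. s \<in> {v..v + h} \<Longrightarrow> r \<in> {v..v + h} \<Longrightarrow> \<bar>f' s - f' r\<bar> \<le> B * \<bar>s - r\<bar>"
  shows "\<bar>f' s - (f (v + h) - f v) / (1 - exp (- h))\<bar> \<le> (A + B) * h"
proof -
  have "\<exists>r\<in>{v<..<v + h}. f (v + h) - f v = (\<lambda>y. f' r * y) (v + h - v)"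
  proof (rule mvt_simple[where f' = "\<lambda>r y. f' r * y"])
    show "(f has_derivative (\<lambda>y. f' r * y)) (at r within {v..v + h})" if "v \<le> r" "r \<le> v + h" for r
      using f[of r] that by (simp add: has_field_derivative_def)
  qed (use \<open>0 < h\<close> in auto)
  then obtain r where "r \<in> {v<..<v + h}" and fr: "f (v + h) - f v = f' r * h"
    by auto
  then have r: "r \<in> {v..v + h}" by auto
  \<comment> \<open>The sign of \<open>B\<close> is read off from the Lipschitz bound at the two
    distinct endpoints.\<close>
  have "0 \<le> B * h"
    using B[of v "v + h"] \<open>0 < h\<close> abs_ge_zero[of "f' v - f' (v + h)"] by (simp del: abs_ge_zero)
  then have "0 \<le> B" using \<open>0 < h\<close> by (simp add: zero_le_mult_iff)
  have "\<bar>f' s - f' r\<bar> \<le> B * \<bar>s - r\<bar>" using B r assms by auto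
  also have "\<dots> \<le> B * h" using r assms \<open>B \<ge> 0\<close> by (intro mult_left_mono) auto
  finally have 1: "\<bar>f' s - f' r\<bar> \<le> B * h" .
  have e: "exp (- h) < 1" "1 - h \<le> exp (- h)" using \<open>0 < h\<close> exp_ge_add_one_self[of "- h"] by auto
  \<comment> \<open>Expanding \<open>(1 + h) * exp (- h) \<le> 1\<close> gives the bound on
    \<open>h / (1 - exp (- h)) - 1\<close>, cleared of its denominator.\<close>
  have "(1 + h) * exp (- h) \<le> exp h * exp (- h)"
    using exp_ge_add_one_self[of h] by (intro mult_right_mono) auto
  then have e2: "h - (1 - exp (- h)) \<le> h * (1 - exp (- h))"
    by (simp add: algebra_simps flip: exp_add)
  have "\<bar>f' r - f' r * h / (1 - exp (- h))\<bar> = \<bar>f' r\<bar> * ((h - (1 - exp (- h))) / (1 - exp (- h)))"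
  proof -
    have "f' r - f' r * h / (1 - exp (- h)) = - (f' r * ((h - (1 - exp (- h))) / (1 - exp (- h))))"
      using e by (simp add: field_simps)
    then show ?thesis using e by (simp add: abs_mult)
  qed
  also have "\<dots> \<le> A * h"
    using e e2 A[OF r] \<open>0 < h\<close> by (intro mult_mono) (auto simp: divide_simps)
  finally have 2: "\<bar>f' r - f' r * h / (1 - exp (- h))\<bar> \<le> A * h" .
  show ?thesis
    unfolding fr using 1 2 by (simp add: distrib_right)
qed

section \<open>Passage to the logarithmic variable\<close>

lemma C2_on_exp_substitution:
  assumes "0 < a" "0 < b" "C2_on a b x"
  shows "C2_on 0 (ln (b / a)) (\<lambda>u. x (a * exp u))"
proof -
  let ?L = "ln (b / a)" and ?g = "\<lambda>u. a * exp u"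
  obtain x' x'' where
    x: "\<And>t. t \<in> {a..b} \<Longrightarrow> (x has_real_derivative x' t) (at t within {a..b})" and
    x': "\<And>t. t \<in> {a..b} \<Longrightarrow> (x' has_real_derivative x'' t) (at t within {a..b})" and
    x'': "continuous_on {a..b} x''"
    using assms(3) unfolding C2_on_def by blast
  have g: "?g u \<in> {a..b}" if "u \<in> {0..?L}" for u
  proof -
    have "exp u \<le> exp ?L" using that by simp
    also have "exp ?L = b / a" using assms by simp
    finally show ?thesis using that assms(1) by (simp add: field_simps)
  qed
  have dg: "(?g has_real_derivative ?g u) (at u within {0..?L})" for u
    by (auto intro!: derivative_eq_intros)
  have comp: "((\<lambda>u. h (?g u)) has_real_derivative h' (?g u) * ?g u) (at u within {0..?L})"
    if "u \<in> {0..?L}" "\<And>t. t \<in> {a..b} \<Longrightarrow> (h has_real_derivative h' t) (at t within {a..b})" for h h' u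
  proof -
    have "(h has_real_derivative h' (?g u)) (at (?g u) within ?g ` {0..?L})"
      using that(2)[OF g[OF that(1)]] by (rule DERIV_subset) (use g in auto)
    from DERIV_image_chain[OF this dg] show ?thesis by (simp add: o_def)
  qed
  have contg: "continuous_on {0..?L} ?g" by (intro continuous_intros)
  have contx': "continuous_on {a..b} x'" by (rule DERIV_continuous_on[OF x'])
  show ?thesis
    unfolding C2_on_def
  proof (intro exI conjI ballI)
    fix u assume u: "u \<in> {0..?L}"
    show "((\<lambda>u. x (?g u)) has_real_derivative x' (?g u) * ?g u) (at u within {0..?L})"
      by (rule comp[OF u x])
    show "((\<lambda>u. x' (?g u) * ?g u) has_real_derivative x'' (?g u) * ?g u * ?g u + ?g u * x' (?g u))
        (at u within {0..?L})"
      by (rule DERIV_mult[OF comp[OF u x'] dg])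
  next
    show "continuous_on {0..?L} (\<lambda>u. x'' (?g u) * ?g u * ?g u + ?g u * x' (?g u))"
      by (intro continuous_on_add continuous_on_mult contg
          continuous_on_compose2[OF x'' contg] continuous_on_compose2[OF contx' contg]) (use g in auto)
  qed
qed

text \<open>Under \<open>s = a * exp u\<close> the Jacobian cancels the factor \<open>1 / s\<close>
  of the integrand, and \<open>ln (t / s) = ln (t / a) - u\<close> turns the Hadamard kernel into a
  convolution kernel.\<close>

lemma hadamard_integral_exp_substitution:
  assumes "0 < a" "a \<le> t"
    and int: "(\<lambda>u. (ln (t / a) - u) powr (- \<alpha>) * x (a * exp u)) absolutely_integrable_on {0..ln (t / a)}"
  shows "hadamard_integrand \<alpha> x t absolutely_integrable_on {a..t}"
    and "hadamard_integral \<alpha> a x t = integral {0..ln (t / a)} (\<lambda>u. (ln (t / a) - u) powr (- \<alpha>) * x (a * exp u))"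
proof -
  let ?T = "ln (t / a)" and ?g = "\<lambda>u. a * exp u"
  have img: "?g ` {0..?T} = {a..t}"
  proof (intro equalityI subsetI)
    fix s assume s: "s \<in> {a..t}"
    then have "s = ?g (ln (s / a))" "ln (s / a) \<in> {0..?T}"
      using assms by (auto simp: divide_right_mono)
    then show "s \<in> ?g ` {0..?T}" by blast
  next
    fix s assume "s \<in> ?g ` {0..?T}"
    then obtain u where u: "s = ?g u" "u \<in> {0..?T}" by blast
    then have "exp u \<le> exp ?T" by simp
    also have "exp ?T = t / a" using assms by simp
    finally show "s \<in> {a..t}" using u assms by (auto simp: field_simps)
  qed
  have eq: "\<bar>?g u\<bar> * hadamard_integrand \<alpha> x t (?g u) = (?T - u) powr (- \<alpha>) * x (?g u)" for u
  proof -
    have "ln (t / ?g u) = ?T - u"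
      using assms by (simp add: ln_div ln_mult)
    then show ?thesis using assms by (simp add: hadamard_integrand_def)
  qed
  \<comment> \<open>Instantiating \<open>I\<close> with the integral over \<open>u\<close> yields
    both conclusions from this one equivalence.\<close>
  have "(\<lambda>u. \<bar>?g u\<bar> * hadamard_integrand \<alpha> x t (?g u)) absolutely_integrable_on {0..?T} \<and>
      integral {0..?T} (\<lambda>u. \<bar>?g u\<bar> * hadamard_integrand \<alpha> x t (?g u)) = I
    \<longleftrightarrow> hadamard_integrand \<alpha> x t absolutely_integrable_on (?g ` {0..?T}) \<and>
      integral (?g ` {0..?T}) (hadamard_integrand \<alpha> x t) = I" for I
    by (rule has_absolute_integral_change_of_variables_1'[where g = ?g and g' = ?g and f = "hadamard_integrand \<alpha> x t", unfolded real_scaleR_def])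
       (use assms(1) in \<open>auto intro!: derivative_eq_intros simp: inj_on_def\<close>)
  then show "hadamard_integrand \<alpha> x t absolutely_integrable_on {a..t}"
    and "hadamard_integral \<alpha> a x t = integral {0..?T} (\<lambda>u. (?T - u) powr (- \<alpha>) * x (?g u))"
    using int unfolding eq img hadamard_integral_def by blast+
qed

section \<open>Global quadrature error on uniform grids\<close>

lemma abel_integral_quadrature_error:
  fixes f f' f'' :: "real \<Rightarrow> real" and p L :: real
  assumes p: "-1 < p" and "0 \<le> L"
    and f: "\<And>s. s \<in> {0..L} \<Longrightarrow> (f has_real_derivative f' s) (at s within {0..L})"
    and f': "\<And>s. s \<in> {0..L} \<Longrightarrow> (f' has_real_derivative f'' s) (at s within {0..L})"
    and f'': "continuous_on {0..L} f''"
  shows "\<exists>C\<ge>0. \<forall>h>0. \<forall>N. real N * h \<le> L \<longrightarrow>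
    \<bar>integral {0..real N * h} (\<lambda>s. (real N * h - s) powr p * f' s)
      - (\<Sum>k=1..N. (f (real k * h) - f (real (k - 1) * h)) / (1 - exp (- h)) *
          (((real N * h - real (k - 1) * h) powr (p + 1) - (real N * h - real k * h) powr (p + 1)) / (p + 1)))\<bar>
    \<le> C * h"
proof -
  have contf': "continuous_on {0..L} f'" by (rule DERIV_continuous_on[OF f'])
  obtain A where A: "\<And>s. s \<in> {0..L} \<Longrightarrow> norm (f' s) \<le> A"
    using compact_imp_bounded[OF compact_continuous_image[OF contf' compact_Icc]]
    unfolding bounded_iff by blast
  obtain B where B: "\<And>s. s \<in> {0..L} \<Longrightarrow> norm (f'' s) \<le> B"
    using compact_imp_bounded[OF compact_continuous_image[OF f'' compact_Icc]]
    unfolding bounded_iff by blast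
  have "0 \<le> A" "0 \<le> B" using A[of 0] B[of 0] \<open>0 \<le> L\<close> by auto
  have lip: "\<bar>f' s - f' r\<bar> \<le> B * \<bar>s - r\<bar>" if "s \<in> {0..L}" "r \<in> {0..L}" for s r
    using field_differentiable_bound[OF _ f' B that] by simp
  \<comment> \<open>\<open>A + B\<close> is the constant of the error per cell, and the second
    factor is the kernel mass of an interval of length \<open>L\<close>, which bounds the total
    weight for every \<open>h\<close> and \<open>N\<close>.\<close>
  define C where "C = (A + B) * (L powr (p + 1) / (p + 1))"
  have "0 \<le> C" using \<open>0 \<le> A\<close> \<open>0 \<le> B\<close> p by (simp add: C_def)
  moreover have "\<bar>integral {0..real N * h} (\<lambda>s. (real N * h - s) powr p * f' s)
      - (\<Sum>k=1..N. (f (real k * h) - f (real (k - 1) * h)) / (1 - exp (- h)) *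
          (((real N * h - real (k - 1) * h) powr (p + 1) - (real N * h - real k * h) powr (p + 1)) / (p + 1)))\<bar>
    \<le> C * h" (is "\<bar>?I - ?S\<bar> \<le> _") if "0 < h" "real N * h \<le> L" for h N
  proof -
    let ?T = "real N * h"
    have cell: "{real k * h..real k * h + h} \<subseteq> {0..L}" if "k < N" for k
    proof -
      have "real (Suc k) * h \<le> real N * h" using that \<open>0 < h\<close> by (intro mult_right_mono) auto
      then show ?thesis using \<open>real N * h \<le> L\<close> \<open>0 < h\<close> by (auto simp: algebra_simps)
    qed
    have "\<bar>?I - ?S\<bar> \<le> ((A + B) * h) * ((?T powr (p + 1) - (?T - ?T) powr (p + 1)) / (p + 1))"
    proof (rule abel_piecewise_constant_error[where u = "\<lambda>k. real k * h" and N = N and g = f'])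
      show "real k * h \<le> real (Suc k) * h" for k using \<open>0 < h\<close> by simp
      have "((\<lambda>s. (?T - s) powr p * f' s) has_integral
          ((?T - 0) powr (p + 1) * f' 0 - (?T - ?T) powr (p + 1) * f' ?T
            + integral {0..?T} (\<lambda>s. (?T - s) powr (p + 1) * f'' s)) / (p + 1)) {0..?T}"
        by (rule has_integral_abel_kernel_by_parts)
           (use p that in \<open>auto intro: DERIV_subset[OF f'] continuous_on_subset[OF f'']\<close>)
      then show "(\<lambda>s. (?T - s) powr p * f' s) integrable_on {0..?T}"
        by (rule has_integral_integrable)
    next
      fix k s assume k: "k < N" and s: "s \<in> {real k * h..real (Suc k) * h}"
      have k1: "real (Suc k) * h = real k * h + h" by (simp add: algebra_simps)
      have "\<bar>f' s - (f (real k * h + h) - f (real k * h)) / (1 - exp (- h))\<bar> \<le> (A + B) * h"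
      proof (rule difference_quotient_error[where f = f and f' = f' and s = s])
        show "s \<in> {real k * h..real k * h + h}" using s k1 by simp
      next
        fix r assume r: "r \<in> {real k * h..real k * h + h}"
        show "(f has_real_derivative f' r) (at r within {real k * h..real k * h + h})"
          by (rule DERIV_subset[OF f[OF subsetD[OF cell[OF k] r]] cell[OF k]])
        show "\<bar>f' r\<bar> \<le> A" using A[OF subsetD[OF cell[OF k] r]] by simp
        show "\<bar>f' r - f' q\<bar> \<le> B * \<bar>r - q\<bar>" if "q \<in> {real k * h..real k * h + h}" for q
          by (rule lip[OF subsetD[OF cell[OF k] r] subsetD[OF cell[OF k] that]])
      qed fact
      then show "\<bar>f' s - (f (real (Suc k) * h) - f (real (Suc k - 1) * h)) / (1 - exp (- h))\<bar> \<le> (A + B) * h"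
        by (simp only: k1 diff_Suc_1)
    qed (use p that in auto)
    also have "\<dots> \<le> ((A + B) * h) * (L powr (p + 1) / (p + 1))"
      using that p \<open>0 \<le> A\<close> \<open>0 \<le> B\<close>
      by (intro mult_left_mono divide_right_mono) (auto intro!: powr_mono2)
    finally show ?thesis by (simp add: C_def mult_ac)
  qed
  ultimately show ?thesis by blast
qed

section \<open>The Hadamard derivative and the scheme in the logarithmic variable\<close>

text \<open>The factor \<open>t\<close> in the Hadamard derivative cancels the \<open>1 / t\<close>
  that the chain rule produces from \<open>ln (t / a)\<close>. All derivatives are taken relative to
  closed intervals, so \<open>t = b\<close> needs no separate treatment.\<close>

lemma hadamard_deriv_eq_abel_integral:
  fixes a b \<alpha> t :: real and x f' f'' :: "real \<Rightarrow> real"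
  defines "f \<equiv> \<lambda>u. x (a * exp u)" and "L \<equiv> ln (b / a)" and "T \<equiv> ln (t / a)"
  assumes a: "0 < a" and t: "a < t" "t \<le> b" and \<alpha>: "0 < \<alpha>" "\<alpha> < 1"
    and f: "\<And>s. s \<in> {0..L} \<Longrightarrow> (f has_real_derivative f' s) (at s within {0..L})"
    and f': "\<And>s. s \<in> {0..L} \<Longrightarrow> (f' has_real_derivative f'' s) (at s within {0..L})"
    and f'': "continuous_on {0..L} f''"
  shows "hadamard_differentiable \<alpha> a b x t"
    and "hadamard_deriv \<alpha> a b x t =
      (T powr (- \<alpha>) * f 0 + integral {0..T} (\<lambda>s. (T - s) powr (- \<alpha>) * f' s)) / Gamma (1 - \<alpha>)"
proof -
  define J where "J = (\<lambda>v. integral {0..v} (\<lambda>s. (v - s) powr (- \<alpha>) * f s))"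
  define D where "D = T powr (- \<alpha>) * f 0 + integral {0..T} (\<lambda>s. (T - s) powr (- \<alpha>) * f' s)"
  have lnL: "ln (u / a) \<in> {0..L}" if "u \<in> {a..b}" for u
    using that a unfolding L_def by (auto simp: divide_right_mono)
  have contf: "continuous_on {0..L} f" by (rule DERIV_continuous_on[OF f])
  have contf': "continuous_on {0..L} f'" by (rule DERIV_continuous_on[OF f'])
  have abs_int: "(\<lambda>s. (v - s) powr (- \<alpha>) * f s) absolutely_integrable_on {0..v}" if "v \<in> {0..L}" for v
  proof (rule abel_integrand_absolutely_integrable)
    have "((\<lambda>s. (v - s) powr (- \<alpha>) * f s) has_integral
        ((v - 0) powr (- \<alpha> + 1) * f 0 - (v - v) powr (- \<alpha> + 1) * f v
          + integral {0..v} (\<lambda>s. (v - s) powr (- \<alpha> + 1) * f' s)) / (- \<alpha> + 1)) {0..v}"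
      by (rule has_integral_abel_kernel_by_parts)
         (use \<alpha> that in \<open>auto intro: DERIV_subset[OF f] continuous_on_subset[OF contf']\<close>)
    then show "(\<lambda>s. (v - s) powr (- \<alpha>) * f s) integrable_on {0..v}"
      by (rule has_integral_integrable)
    show "continuous_on {0..v} f" by (rule continuous_on_subset[OF contf]) (use that in auto)
  qed (use \<alpha> that in auto)
  have sub: "hadamard_integrand \<alpha> x u absolutely_integrable_on {a..u}"
       "hadamard_integral \<alpha> a x u = J (ln (u / a))" if "u \<in> {a..b}" for u
    using hadamard_integral_exp_substitution[of a u \<alpha> x] abs_int[OF lnL[OF that]] a that
    unfolding J_def f_def by auto
  have T: "0 < T" "T \<le> L"
    using a t lnL[of t] by (auto simp: T_def)
  have "(J has_real_derivative D) (at T within {0..L})"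
    unfolding J_def D_def by (rule has_real_derivative_abel_integral) (use \<alpha> T f f' f'' in auto)
  then have "(J has_real_derivative D) (at (ln (t / a)) within (\<lambda>u. ln (u / a)) ` {a..b})"
    unfolding T_def by (rule DERIV_subset) (use lnL in auto)
  moreover have "((\<lambda>u. ln (u / a)) has_real_derivative 1 / t) (at t within {a..b})"
    using a t by (auto intro!: derivative_eq_intros)
  ultimately have "(J \<circ> (\<lambda>u. ln (u / a)) has_real_derivative D * (1 / t)) (at t within {a..b})"
    by (rule DERIV_image_chain)
  then have der: "(hadamard_integral \<alpha> a x has_real_derivative D * (1 / t)) (at t within {a..b})"
    by (rule has_field_derivative_transform_within[OF _ zero_less_one]) (use t sub in auto)
  then have "hadamard_integral \<alpha> a x differentiable (at t within {a..b})"
    using real_differentiable_def by blast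
  then show "hadamard_differentiable \<alpha> a b x t"
    using sub(1) by (simp add: hadamard_differentiable_def)
  have "vector_derivative (hadamard_integral \<alpha> a x) (at t within {a..b}) = D * (1 / t)"
    using der t by (intro vector_derivative_within_closed_interval)
      (auto simp: has_real_derivative_iff_has_vector_derivative)
  then show "hadamard_deriv \<alpha> a b x t = (T powr (- \<alpha>) * f 0 + integral {0..T} (\<lambda>s. (T - s) powr (- \<alpha>) * f' s)) / Gamma (1 - \<alpha>)"
    using a t by (simp add: hadamard_deriv_def D_def)
qed

text \<open>Exhibits the scheme as a product quadrature. The quotient of \<open>node a b n k\<close>
  by \<open>exp (real k * h n)\<close> is \<open>a\<close>, which cancels the \<open>a\<close> in
  \<open>psi\<close>, and
  \<open>Gamma (2 - \<alpha>) = (1 - \<alpha>) * Gamma (1 - \<alpha>)\<close> supplies the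
  \<open>1 - \<alpha>\<close> of the kernel antiderivative.\<close>

lemma hadamard_approx_eq:
  fixes a b \<alpha> :: real and x :: "real \<Rightarrow> real"
  defines "f \<equiv> \<lambda>u. x (a * exp u)" and "h \<equiv> \<lambda>n. log_step a b n"
  assumes a: "0 < a" "a < b" and \<alpha>: "\<alpha> < 1" and n: "1 \<le> n"
  shows "hadamard_approx \<alpha> a b x n N =
    ((real N * h n) powr (- \<alpha>) * f 0 +
     (\<Sum>k=1..N. (f (real k * h n) - f (real (k - 1) * h n)) / (1 - exp (- h n)) *
        (((real N * h n - real (k - 1) * h n) powr (1 - \<alpha>) - (real N * h n - real k * h n) powr (1 - \<alpha>)) / (1 - \<alpha>))))
    / Gamma (1 - \<alpha>)"
proof -
  have h: "0 < h n" using a n by (simp add: h_def log_step_def)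
  have G: "Gamma (2 - \<alpha>) = (1 - \<alpha>) * Gamma (1 - \<alpha>)"
    using Gamma_plus1[of "1 - \<alpha>"] \<alpha> nonpos_Ints_nonpos[of "1 - \<alpha>"] by fastforce
  \<comment> \<open>Up to the factor \<open>1 - \<alpha>\<close>, this is the exact integral of the
    kernel over the \<open>k\<close>-th cell. For \<open>k = N\<close> the last term is
    \<open>0 powr (1 - \<alpha>) = 0\<close>.\<close>
  have w: "h n powr (1 - \<alpha>) * omega \<alpha> (N - k + 1) =
      (real N * h n - real (k - 1) * h n) powr (1 - \<alpha>) - (real N * h n - real k * h n) powr (1 - \<alpha>)"
    if "k \<in> {1..N}" for k
  proof -
    have "real N * h n - real (k - 1) * h n = h n * real (N - k + 1)"
         "real N * h n - real k * h n = h n * (real (N - k + 1) - 1)"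
      using that by (simp_all add: algebra_simps)
    then show ?thesis
      using h by (simp add: omega_def powr_mult right_diff_distrib)
  qed
  have node: "node a b n k = a * exp (real k * h n)" for k by (simp add: node_def h_def)
  have "psi \<alpha> a b n * (\<Sum>k=1..N. omega \<alpha> (N - k + 1) *
          ((x (node a b n k) - x (node a b n (k - 1))) / exp (real k * log_step a b n)) * node a b n k) =
     (\<Sum>k=1..N. (f (real k * h n) - f (real (k - 1) * h n)) / (1 - exp (- h n)) *
        ((h n powr (1 - \<alpha>) * omega \<alpha> (N - k + 1)) / (1 - \<alpha>))) / Gamma (1 - \<alpha>)"
    unfolding sum_distrib_left sum_divide_distrib psi_def node h_def[symmetric] f_def G
    using a by (intro sum.cong) (auto simp: mult_ac)
  also have "(\<Sum>k=1..N. (f (real k * h n) - f (real (k - 1) * h n)) / (1 - exp (- h n)) *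
        ((h n powr (1 - \<alpha>) * omega \<alpha> (N - k + 1)) / (1 - \<alpha>))) =
     (\<Sum>k=1..N. (f (real k * h n) - f (real (k - 1) * h n)) / (1 - exp (- h n)) *
        (((real N * h n - real (k - 1) * h n) powr (1 - \<alpha>) - (real N * h n - real k * h n) powr (1 - \<alpha>)) / (1 - \<alpha>)))"
    by (intro sum.cong refl) (simp only: w)
  finally show ?thesis
    unfolding hadamard_approx_def using a by (simp add: node f_def add_divide_distrib)
qed

section \<open>Uniform bound and convergence of the remainder\<close>

theorem theorem1:
  fixes a b \<alpha> :: real and x :: "real \<Rightarrow> real"
  assumes "0 < a" and "a < b" and "0 < \<alpha>" and "\<alpha> < 1" and "C2_on a b x"
  shows "\<exists>(R :: nat \<Rightarrow> nat \<Rightarrow> real) (C :: real).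
    (\<forall>n\<ge>1. \<forall>N\<in>{1..n}.
       hadamard_differentiable \<alpha> a b x (node a b n N) \<and>
       hadamard_deriv \<alpha> a b x (node a b n N) = hadamard_approx \<alpha> a b x n N + R n N \<and>
       \<bar>R n N\<bar> \<le> C * log_step a b n) \<and>
    (\<lambda>n. MAX N\<in>{1..n}. \<bar>R n N\<bar>) \<longlonglongrightarrow> 0"
proof -
  define L where "L = ln (b / a)"
  define f where "f = (\<lambda>u. x (a * exp u))"
  \<comment> \<open>The decomposition holds by this choice; what remains is differentiability and
    the bound.\<close>
  define R where "R = (\<lambda>n N. hadamard_deriv \<alpha> a b x (node a b n N) - hadamard_approx \<alpha> a b x n N)"
  have "0 < L" using assms by (simp add: L_def)
  obtain f' f'' where
    f: "\<And>s. s \<in> {0..L} \<Longrightarrow> (f has_real_derivative f' s) (at s within {0..L})" and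
    f': "\<And>s. s \<in> {0..L} \<Longrightarrow> (f' has_real_derivative f'' s) (at s within {0..L})" and
    f'': "continuous_on {0..L} f''"
    using C2_on_exp_substitution[OF assms(1) less_trans[OF assms(1,2)] assms(5)] unfolding C2_on_def f_def L_def by blast
  obtain C where "0 \<le> C" and C: "\<And>h N. 0 < h \<Longrightarrow> real N * h \<le> L \<Longrightarrow>
    \<bar>integral {0..real N * h} (\<lambda>s. (real N * h - s) powr (- \<alpha>) * f' s)
      - (\<Sum>k=1..N. (f (real k * h) - f (real (k - 1) * h)) / (1 - exp (- h)) *
          (((real N * h - real (k - 1) * h) powr (1 - \<alpha>) - (real N * h - real k * h) powr (1 - \<alpha>)) / (1 - \<alpha>)))\<bar>
    \<le> C * h"
    using abel_integral_quadrature_error[of "- \<alpha>" L f f' f''] f f' f'' \<open>0 < L\<close> assms(4) by auto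
  have G: "0 < Gamma (1 - \<alpha>)" using assms by (intro Gamma_real_pos) auto
  have main: "hadamard_differentiable \<alpha> a b x (node a b n N)"
       "\<bar>R n N\<bar> \<le> C / Gamma (1 - \<alpha>) * log_step a b n" if n: "1 \<le> n" and N: "N \<in> {1..n}" for n N
  proof -
    let ?h = "log_step a b n"
    have h: "0 < ?h" "real n * ?h = L" using n \<open>0 < L\<close> by (simp_all add: log_step_def L_def)
    have NL: "real N * ?h \<le> L"
      unfolding h(2)[symmetric] using N h by (intro mult_right_mono) auto
    have T: "ln (node a b n N / a) = real N * ?h" using assms by (simp add: node_def)
    have "exp (real N * ?h) \<le> exp L" using NL by simp
    also have "exp L = b / a" using assms by (simp add: L_def)
    finally have t: "a < node a b n N" "node a b n N \<le> b"
      using assms(1) N h by (auto simp: node_def field_simps)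
    note d = hadamard_deriv_eq_abel_integral[where x = x, OF assms(1) t assms(3,4),
        folded f_def L_def, OF f f' f'', unfolded T]
    show "hadamard_differentiable \<alpha> a b x (node a b n N)"
      by (rule d(1))
    have deriv: "hadamard_deriv \<alpha> a b x (node a b n N) = ((real N * ?h) powr (- \<alpha>) * f 0
        + integral {0..real N * ?h} (\<lambda>s. (real N * ?h - s) powr (- \<alpha>) * f' s)) / Gamma (1 - \<alpha>)"
      using d(2) by (simp add: f_def)
    \<comment> \<open>The scheme reproduces the boundary term
      \<open>T powr (- \<alpha>) * f 0\<close> exactly, so only the quadrature error
      survives.\<close>
    have "R n N = (integral {0..real N * ?h} (\<lambda>s. (real N * ?h - s) powr (- \<alpha>) * f' s)
      - (\<Sum>k=1..N. (f (real k * ?h) - f (real (k - 1) * ?h)) / (1 - exp (- ?h)) *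
          (((real N * ?h - real (k - 1) * ?h) powr (1 - \<alpha>) - (real N * ?h - real k * ?h) powr (1 - \<alpha>)) / (1 - \<alpha>))))
      / Gamma (1 - \<alpha>)"
      unfolding R_def deriv hadamard_approx_eq[OF assms(1,2,4) n, folded f_def]
      by (simp add: diff_divide_distrib add_divide_distrib f_def)
    then show "\<bar>R n N\<bar> \<le> C / Gamma (1 - \<alpha>) * ?h"
      using C[OF h(1) NL] G by (simp add: divide_right_mono)
  qed
  let ?C = "C / Gamma (1 - \<alpha>)"
  have "(\<lambda>n. MAX N\<in>{1..n}. \<bar>R n N\<bar>) \<longlonglongrightarrow> 0"
  \<comment> \<open>The bounds are claimed only for \<open>n \<ge> 1\<close>, since for
    \<open>n = 0\<close> the maximum ranges over the empty set.\<close>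
  proof (rule real_tendsto_sandwich)
    show "\<forall>\<^sub>F n in sequentially. 0 \<le> (MAX N\<in>{1..n}. \<bar>R n N\<bar>)"
      using eventually_ge_at_top[of 1]
      by eventually_elim (auto simp: Max_ge_iff)
    show "\<forall>\<^sub>F n in sequentially. (MAX N\<in>{1..n}. \<bar>R n N\<bar>) \<le> ?C * log_step a b n"
      using eventually_ge_at_top[of 1]
      by eventually_elim (auto simp del: times_divide_eq_left intro: main(2))
    show "(\<lambda>n. ?C * log_step a b n) \<longlonglongrightarrow> 0"
      unfolding log_step_def by (intro tendsto_mult_right_zero lim_const_over_n)
  qed simp
  moreover have "\<forall>n\<ge>1. \<forall>N\<in>{1..n}.
       hadamard_differentiable \<alpha> a b x (node a b n N) \<and>
       hadamard_deriv \<alpha> a b x (node a b n N) = hadamard_approx \<alpha> a b x n N + R n N \<and>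
       \<bar>R n N\<bar> \<le> ?C * log_step a b n"
    using main by (simp add: R_def)
  ultimately show ?thesis by blast
qed

end
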